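(* Let $\mathcal{X}_1,\dots,\mathcal{X}_s$ be finite experimental regions, let $\Xi_i$ be the set of all designs (probability measures) on $\mathcal{X}_i$, $i=1,\dots,s$, and let $\Xi=\Xi_1\times\cdots\times\Xi_s$. Let $\phi:\Xi\to(-\infty,\infty]$ be convex and differentiable. a) For $\boldsymbol{\xi}^*=(\xi_1^*,\dots,\xi_s^* )\in\Xi$ the following statements are equivalent: (i) $\boldsymbol{\xi}^*$ minimizes $\phi(\boldsymbol{\xi})$ over $\boldsymbol{\xi}\in\Xi$; (ii) $\sum_{i=1}^s\Phi_{\xi_{i'}^*,\,i'\neq i}(\xi_i^*,\xi_i)\ge 0$ for all $\xi_i\in\Xi_i$, $i=1,\dots,s$; (iii) $\Phi_{\xi_{i'}^*,\,i'\neq i}(\xi_i^*,\xi_i)\ge 0$ for all $\xi_i\in\Xi_i$, $i=1,\dots,s$; (iv) $\Phi_{\xi_{i'}^*,\,i'\neq i}(\xi_i^*,\delta_{x_i})\ge 0$ for all $x_i\in\mathcal{X}_i$, $i=1,\dots,s$. b) Let $\boldsymbol{\xi}^*=(\xi_1^*,\dots,\xi_s^* )$ minimize $\phi(\boldsymbol{\xi})$, and let $x_i$ be a support point of $\xi_i^*$, $i\in\{1,\dots,s\}$. Then $\Phi_{\xi_{i'}^*,\,i'\neq i}(\xi_i^*,\delta_{x_i})=0$. c) Let $\boldsymbol{\xi}^*=(\xi_1^*,\dots,\xi_s^* )$ minimize $\phi(\boldsymbol{\xi})$. Then the point $(\boldsymbol{\xi}^*,\boldsymbol{\xi}^* )$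 is a saddle point of $\Phi$ in that $$\Phi(\boldsymbol{\xi}^*,\boldsymbol{\xi})\ \ge\ 0=\Phi(\boldsymbol{\xi}^*,\boldsymbol{\xi}^* )\ \ge\ \Phi(\tilde{\boldsymbol{\xi}},\boldsymbol{\xi}^* )\qquad\text{for all }\boldsymbol{\xi},\tilde{\boldsymbol{\xi}}\in\Xi,$$ and the point $(\xi_i^*,\xi_i^* )$ is a saddle point of $\Phi_{\xi_{i'}^*,\,i'\neq i}$ in that $$\Phi_{\xi_{i'}^*,\,i'\neq i}(\xi_i^*,\xi_i)\ \ge\ 0=\Phi_{\xi_{i'}^*,\,i'\neq i}(\xi_i^*,\xi_i^* )\ \ge\ \Phi_{\xi_{i'}^*,\,i'\neq i}(\tilde\xi_i,\xi_i^* )\qquad\text{for all }\xi_i,\tilde\xi_i\in\Xi_i,$$ for all $i=1,\dots,s$.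
   Context: $\phi$ is a design criterion, to be minimized, which depends on the designs $\xi_1,\dots,\xi_s$ simultaneously; $\boldsymbol{\xi}=(\xi_1,\dots,\xi_s)$ denotes the vector of designs. For $x_i\in\mathcal{X}_i$, $\delta_{x_i}$ denotes the one-point design on $\mathcal{X}_i$ with all observations at $x_i$. Since $|\mathcal{X}_i|=k_i<\infty$, a design $\xi_i$ is identified with the vector of its weights $(w_{i1},\dots,w_{ik_i})$, where $w_{it}\ge 0$ is the weight at the $t$-th point of $\mathcal{X}_i$ and $\sum_{t=1}^{k_i}w_{it}=1$; convexity and differentiability of $\phi$ are understood with respect to the full vector of all weights, and convex combinations of vectors of designs are taken componentwise. A support point of $\xi_i$ is a point of $\mathcal{X}_i$ with positive weight. The directional derivative of $\phi$ at $\boldsymbol{\xi}$ in direction of $\tilde{\boldsymbol{\xi}}$ is $$\Phi(\boldsymbol{\xi},\tilde{\boldsymbol{\xi}})=\lim_{\alpha\searrow 0}\frac1\alpha\Big(\phi((1-\alpha)\boldsymbol{\xi}+\alpha\tilde{\boldsymbol{\xi}})-\phi(\boldsymbol{\xi})\Big).$$ The partial directional derivative of $\phi$ at $\xi_i$ in direction of $\tilde\xi_i$ (with the other components $\xi_{i'}$, $i'\neq i$, fixed) is $$\Phi_{\xi_{i'},\,i'\neq i}(\xi_i,\tilde\xi_i)=\Phi(\boldsymbol{\xi},\breve{\boldsymbol{\xi}}),$$ where $\breve{\boldsymbol{\xi}}=(\breve\xi_1,\dots,\breve\xi_s)$ with $\breve\xi_{i'}=\xi_{i'}$ for $i'\neq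 i$ and $\breve\xi_i=\tilde\xi_i$. *)

theory Defs
  imports "HOL-Analysis.Analysis"
begin

text \<open>
  A design is identified with its vector of weights. All experimental regions \<open>X i\<close> are subsets
  of one common finite type of points (for instance their disjoint union); a weight vector on
  \<open>X i\<close> is a vector indexed by that type which vanishes off \<open>X i\<close>. The index type \<open>'s\<close> plays the
  role of \<open>{1, ..., s}\<close>.
\<close>

definition designs :: "'a::finite set \<Rightarrow> (real ^ 'a) set" where
  "designs A = {w. (\<forall>x. 0 \<le> w $ x) \<and> (\<forall>x. x \<notin> A \<longrightarrow> w $ x = 0) \<and> (\<Sum>x\<in>A. w $ x) = 1}"

definition design_vectors :: "('s::finite \<Rightarrow> 'a::finite set) \<Rightarrow> (real ^ 'a ^ 's) set" where
  "design_vectors X = {\<xi>. \<forall>i. \<xi> $ i \<in> designs (X i)}"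

definition one_point :: "'a::finite \<Rightarrow> real ^ 'a" where
  "one_point x = axis x 1"

definition replace_component ::
    "real ^ 'a ^ 's \<Rightarrow> 's::finite \<Rightarrow> real ^ 'a::finite \<Rightarrow> real ^ 'a ^ 's" where
  "replace_component \<xi> i w = (\<chi> j. if j = i then w else \<xi> $ j)"

definition ereal_convex_on :: "'v::real_vector set \<Rightarrow> ('v \<Rightarrow> ereal) \<Rightarrow> bool" where
  "ereal_convex_on S f \<longleftrightarrow> convex S \<and>
     (\<forall>x\<in>S. \<forall>y\<in>S. \<forall>\<alpha>::real. 0 < \<alpha> \<and> \<alpha> < 1 \<longrightarrow>
        f ((1 - \<alpha>) *\<^sub>R x + \<alpha> *\<^sub>R y) \<le> ereal (1 - \<alpha>) * f x + ereal \<alpha> * f y)"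

text \<open>
  Differentiability of a function with values in \<open>(-\<infinity>, \<infinity>]\<close> can only be asked for at points where
  it is finite. There it means that the function is finite near the point, relative to \<open>S\<close>, and
  has a Frechet derivative relative to \<open>S\<close>. The finiteness has to be stated because
  \<open>real_of_ereal \<infinity> = 0\<close>.
\<close>

definition ereal_differentiable_on :: "('v::real_normed_vector \<Rightarrow> ereal) \<Rightarrow> 'v set \<Rightarrow> bool" where
  "ereal_differentiable_on f S \<longleftrightarrow>
     (\<forall>x\<in>S. f x \<noteq> \<infinity> \<longrightarrow>
        (\<forall>\<^sub>F y in at x within S. f y \<noteq> \<infinity>) \<and>
        (\<lambda>y. real_of_ereal (f y)) differentiable (at x within S))"

text \<open>
  If \<open>\<phi> \<xi> = \<infinity>\<close>, the difference quotient is \<open>-\<infinity>\<close> wherever \<open>\<phi>\<close> is finite on the segment, and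
  reads \<open>\<infinity> - \<infinity>\<close> elsewhere. The value \<open>-\<infinity>\<close> is adopted in both cases; it is set separately since
  \<open>\<infinity> - \<infinity> = \<infinity>\<close> holds for type \<open>ereal\<close>.
\<close>

definition dir_deriv :: "('v::real_vector \<Rightarrow> ereal) \<Rightarrow> 'v \<Rightarrow> 'v \<Rightarrow> ereal" where
  "dir_deriv \<phi> \<xi> \<eta> =
     (if \<phi> \<xi> = \<infinity> then -\<infinity>
      else Lim (at_right (0::real))
             (\<lambda>\<alpha>. ereal (1 / \<alpha>) * (\<phi> ((1 - \<alpha>) *\<^sub>R \<xi> + \<alpha> *\<^sub>R \<eta>) - \<phi> \<xi>)))"

text \<open>
  Derivative at \<open>v\<close> in direction \<open>w\<close> with respect to component \<open>i\<close>; the other components are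
  those of \<open>\<xi>\<close>, whose own component \<open>i\<close> is irrelevant.
\<close>

definition partial_dir_deriv ::
    "(real ^ 'a::finite ^ 's::finite \<Rightarrow> ereal) \<Rightarrow> real ^ 'a ^ 's \<Rightarrow> 's \<Rightarrow>
     real ^ 'a \<Rightarrow> real ^ 'a \<Rightarrow> ereal" where
  "partial_dir_deriv \<phi> \<xi> i v w =
     dir_deriv \<phi> (replace_component \<xi> i v) (replace_component \<xi> i w)"

definition minimizes :: "('v \<Rightarrow> ereal) \<Rightarrow> 'v set \<Rightarrow> 'v \<Rightarrow> bool" where
  "minimizes \<phi> S \<xi> \<longleftrightarrow> \<xi> \<in> S \<and> (\<forall>\<eta>\<in>S. \<phi> \<xi> \<le> \<phi> \<eta>)"

end

theory Submission
  imports Defs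
begin

text \<open>
  At a point where \<open>\<phi>\<close> is finite, differentiability relative to the design space makes
  the directional derivative a linear function \<open>D\<close> of the increment \<open>\<eta> - \<xi>\<close>, and by convexity
  \<open>D (\<eta> - \<xi>) \<le> \<phi> \<eta> - \<phi> \<xi>\<close>. The increment \<open>\<eta> - \<xi>\<close> is the sum of the increments obtained by
  replacing one component at a time, and replacing component \<open>i\<close> by a design \<open>w\<close> is the
  \<open>w\<close>-weighted sum of the replacements by one-point designs; linearity of \<open>D\<close> does the rest.
  At a point where \<open>\<phi>\<close> is infinite all the derivatives are \<open>-\<infinity>\<close>.
\<close>

section \<open>Directional derivatives of extended-real functions on a convex set\<close>

lemma dir_deriv_at_infinite [simp]: "\<phi> \<xi> = \<infinity> \<Longrightarrow> dir_deriv \<phi> \<xi> \<eta> = -\<infinity>"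
  by (simp add: dir_deriv_def)

lemma convex_line_mem:
  fixes \<xi> \<eta> :: "'v::real_vector"
  assumes "convex S" "\<xi> \<in> S" "\<eta> \<in> S" "0 \<le> \<alpha>" "\<alpha> \<le> 1"
  shows "(1 - \<alpha>) *\<^sub>R \<xi> + \<alpha> *\<^sub>R \<eta> \<in> S"
  using convexD[OF assms(1-3), of "1 - \<alpha>" \<alpha>] assms(4,5) by simp

text \<open>Chain rule along the segment from \<xi> to \<eta>, applied to the real-valued version of
  \<phi>. The map \<open>D\<close> is the Frechet derivative relative to \<open>S\<close>, chosen
  before \<eta>, so a single linear map serves all directions.\<close>

lemma ereal_differentiable_on_quotient_tendsto:
  fixes \<phi> :: "'v::real_normed_vector \<Rightarrow> ereal"
  assumes S: "convex S" and nm: "\<forall>\<xi>\<in>S. \<phi> \<xi> \<noteq> -\<infinity>" and diff: "ereal_differentiable_on \<phi> S"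
    and \<xi>: "\<xi> \<in> S" "\<phi> \<xi> \<noteq> \<infinity>"
  shows "\<exists>D. linear D \<and> (\<forall>\<eta>\<in>S.
      ((\<lambda>\<alpha>. ereal (1 / \<alpha>) * (\<phi> ((1 - \<alpha>) *\<^sub>R \<xi> + \<alpha> *\<^sub>R \<eta>) - \<phi> \<xi>))
         \<longlongrightarrow> ereal (D (\<eta> - \<xi>))) (at_right (0::real)))"
proof -
  define g where "g = (\<lambda>y. real_of_ereal (\<phi> y))"
  from diff \<xi> obtain D where D: "(g has_derivative D) (at \<xi> within S)"
    and fin: "\<forall>\<^sub>F y in at \<xi> within S. \<phi> y \<noteq> \<infinity>"
    unfolding ereal_differentiable_on_def differentiable_def g_def by blast
  have lin: "linear D"
    using D by (rule has_derivative_linear)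
  have lim: "((\<lambda>\<alpha>. ereal (1 / \<alpha>) * (\<phi> ((1 - \<alpha>) *\<^sub>R \<xi> + \<alpha> *\<^sub>R \<eta>) - \<phi> \<xi>))
         \<longlongrightarrow> ereal (D (\<eta> - \<xi>))) (at_right (0::real))" if \<eta>: "\<eta> \<in> S" for \<eta>
  proof -
    define l where "l = (\<lambda>\<alpha>::real. (1 - \<alpha>) *\<^sub>R \<xi> + \<alpha> *\<^sub>R \<eta>)"
    have l0: "l 0 = \<xi>"
      by (simp add: l_def)
    have lS: "l \<alpha> \<in> S" if "\<alpha> \<in> {0..1}" for \<alpha>
      using convex_line_mem[OF S \<xi>(1) \<eta>] that by (simp add: l_def)
    have l_alt: "l = (\<lambda>\<alpha>. \<xi> + \<alpha> *\<^sub>R (\<eta> - \<xi>))"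
      by (simp add: l_def fun_eq_iff algebra_simps)
    have "(l has_derivative (\<lambda>\<alpha>. \<alpha> *\<^sub>R (\<eta> - \<xi>))) (at 0 within {0..1})"
      unfolding l_alt by (auto intro!: derivative_eq_intros)
    moreover have "(g has_derivative D) (at (l 0) within l ` {0..1})"
      unfolding l0 by (rule has_derivative_subset[OF D]) (use lS in blast)
    ultimately have "((\<lambda>\<alpha>. g (l \<alpha>)) has_derivative (\<lambda>\<alpha>. D (\<alpha> *\<^sub>R (\<eta> - \<xi>)))) (at 0 within {0..1})"
      by (rule has_derivative_in_compose)
    then have "((\<lambda>\<alpha>. g (l \<alpha>)) has_real_derivative D (\<eta> - \<xi>)) (at 0 within {0..1})"
      by (simp add: has_field_derivative_def linear_scale[OF lin] mult_commute_abs)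
    then have quot: "((\<lambda>\<alpha>. (g (l \<alpha>) - g \<xi>) / \<alpha>) \<longlongrightarrow> D (\<eta> - \<xi>)) (at_right 0)"
      by (simp add: has_field_derivative_iff at_within_Icc_at_right l0)
    have unit: "\<forall>\<^sub>F \<alpha> in at_right (0::real). \<alpha> \<in> {0<..<1}"
      by (rule eventually_at_right_real) simp
    \<comment> \<open>\<open>fin\<close> says nothing about the point \<xi> itself; finiteness there
      is the assumption on \<phi> \<xi>. Both together cover a full ball in \<open>S\<close>, hence
      also the constant segment \<eta> = \<xi>.\<close>
    from fin obtain d where d: "d > 0" "\<And>y. y \<in> S \<Longrightarrow> dist y \<xi> < d \<Longrightarrow> \<phi> y \<noteq> \<infinity>"
      using \<xi>(2) unfolding eventually_at by metis
    have "(l \<longlongrightarrow> l 0) (at_right 0)"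
      unfolding l_alt by (auto intro!: tendsto_eq_intros)
    then have "\<forall>\<^sub>F \<alpha> in at_right 0. dist (l \<alpha>) \<xi> < d"
      using d(1) l0 by (auto dest: tendstoD)
    \<comment> \<open>The real and the extended quotient agree only while \<phi> is finite on the
      segment, since \<open>real_of_ereal\<close> sends \<infinity> to 0; small \<alpha> keeps
      \<open>l \<alpha>\<close> inside the ball of finiteness.\<close>
    with unit have "\<forall>\<^sub>F \<alpha> in at_right 0.
        ereal ((g (l \<alpha>) - g \<xi>) / \<alpha>) = ereal (1 / \<alpha>) * (\<phi> (l \<alpha>) - \<phi> \<xi>)"
    proof eventually_elim
      case (elim \<alpha>)
      then have "l \<alpha> \<in> S"
        by (intro lS) auto
      then have "\<bar>\<phi> (l \<alpha>)\<bar> \<noteq> \<infinity>" "\<bar>\<phi> \<xi>\<bar> \<noteq> \<infinity>"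
        using elim d(2) nm \<xi> by auto
      then show ?case
        unfolding g_def by (cases "\<phi> (l \<alpha>)"; cases "\<phi> \<xi>") auto
    qed
    with tendsto_ereal[OF quot] show ?thesis
      unfolding l_def by (rule Lim_transform_eventually)
  qed
  with lin show ?thesis
    by blast
qed

lemma dir_deriv_linear:
  fixes \<phi> :: "'v::real_normed_vector \<Rightarrow> ereal"
  assumes "convex S" "\<forall>\<xi>\<in>S. \<phi> \<xi> \<noteq> -\<infinity>" "ereal_differentiable_on \<phi> S"
    and "\<xi> \<in> S" "\<phi> \<xi> \<noteq> \<infinity>"
  shows "\<exists>D. linear D \<and> (\<forall>\<eta>\<in>S. dir_deriv \<phi> \<xi> \<eta> = ereal (D (\<eta> - \<xi>)))"
  using ereal_differentiable_on_quotient_tendsto[OF assms]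
  by (rule ex_forward) (auto simp: dir_deriv_def assms(5) intro!: tendsto_Lim)

text \<open>\<open>Lim\<close> carries information only once convergence is known. In this form,
  order bounds on the quotients pass to the derivative.\<close>

lemma dir_deriv_tendsto:
  fixes \<phi> :: "'v::real_normed_vector \<Rightarrow> ereal"
  assumes "convex S" "\<forall>\<xi>\<in>S. \<phi> \<xi> \<noteq> -\<infinity>" "ereal_differentiable_on \<phi> S"
    and "\<xi> \<in> S" "\<phi> \<xi> \<noteq> \<infinity>" and "\<eta> \<in> S"
  shows "((\<lambda>\<alpha>. ereal (1 / \<alpha>) * (\<phi> ((1 - \<alpha>) *\<^sub>R \<xi> + \<alpha> *\<^sub>R \<eta>) - \<phi> \<xi>))
     \<longlongrightarrow> dir_deriv \<phi> \<xi> \<eta>) (at_right (0::real))"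
proof -
  obtain l where l: "((\<lambda>\<alpha>. ereal (1 / \<alpha>) * (\<phi> ((1 - \<alpha>) *\<^sub>R \<xi> + \<alpha> *\<^sub>R \<eta>) - \<phi> \<xi>))
     \<longlongrightarrow> l) (at_right (0::real))"
    using ereal_differentiable_on_quotient_tendsto[OF assms(1-5)] assms(6) by blast
  then have "dir_deriv \<phi> \<xi> \<eta> = l"
    using assms(5) by (simp add: dir_deriv_def tendsto_Lim)
  with l show ?thesis
    by simp
qed

text \<open>Convexity bounds every quotient with 0 < \<alpha> < 1 by the quotient at \<alpha> = 1,
  and the bound survives the limit. If \<phi> \<xi> = \<infinity>, the left-hand side is
  -\<infinity>.\<close>

lemma dir_deriv_le_diff:
  fixes \<phi> :: "'v::real_normed_vector \<Rightarrow> ereal"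
  assumes nm: "\<forall>\<xi>\<in>S. \<phi> \<xi> \<noteq> -\<infinity>" and conv: "ereal_convex_on S \<phi>"
    and diff: "ereal_differentiable_on \<phi> S" and \<xi>: "\<xi> \<in> S" and \<eta>: "\<eta> \<in> S" "\<phi> \<eta> \<noteq> \<infinity>"
  shows "dir_deriv \<phi> \<xi> \<eta> \<le> \<phi> \<eta> - \<phi> \<xi>"
proof (cases "\<phi> \<xi> = \<infinity>")
  case False
  have S: "convex S"
    using conv by (simp add: ereal_convex_on_def)
  have lim: "((\<lambda>\<alpha>. ereal (1 / \<alpha>) * (\<phi> ((1 - \<alpha>) *\<^sub>R \<xi> + \<alpha> *\<^sub>R \<eta>) - \<phi> \<xi>))
     \<longlongrightarrow> dir_deriv \<phi> \<xi> \<eta>) (at_right (0::real))"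
    by (rule dir_deriv_tendsto[OF S nm diff \<xi> False \<eta>(1)])
  have "\<forall>\<^sub>F \<alpha> in at_right (0::real). \<alpha> \<in> {0<..<1}"
    by (rule eventually_at_right_real) simp
  then have "\<forall>\<^sub>F \<alpha> in at_right 0.
      ereal (1 / \<alpha>) * (\<phi> ((1 - \<alpha>) *\<^sub>R \<xi> + \<alpha> *\<^sub>R \<eta>) - \<phi> \<xi>) \<le> \<phi> \<eta> - \<phi> \<xi>"
  proof eventually_elim
    case (elim \<alpha>)
    let ?z = "(1 - \<alpha>) *\<^sub>R \<xi> + \<alpha> *\<^sub>R \<eta>"
    have "?z \<in> S"
      using convex_line_mem[OF S \<xi> \<eta>(1)] elim by simp
    moreover have "\<phi> ?z \<le> ereal (1 - \<alpha>) * \<phi> \<xi> + ereal \<alpha> * \<phi> \<eta>"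
      using conv \<xi> \<eta>(1) elim by (auto simp: ereal_convex_on_def)
    moreover obtain a b where "\<phi> \<xi> = ereal a" "\<phi> \<eta> = ereal b"
      using nm \<xi> \<eta> False by (cases "\<phi> \<xi>"; cases "\<phi> \<eta>") auto
    moreover have "\<phi> ?z \<noteq> -\<infinity>"
      using nm \<open>?z \<in> S\<close> by blast
    ultimately show ?case
      using elim by (cases "\<phi> ?z") (simp_all add: field_simps)
  qed
  with lim show ?thesis
    by (rule tendsto_upperbound) simp
qed simp

text \<open>At a minimizer all quotients are nonnegative; conversely,
  \<open>dir_deriv_le_diff\<close> turns a nonnegative derivative into a comparison of values.
  Properness makes a minimizer finite: if \<phi> were \<infinity> throughout, every point would
  minimize although all derivatives are -\<infinity>.\<close>

lemma minimizes_iff_dir_deriv_nonneg: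
  fixes \<phi> :: "'v::real_normed_vector \<Rightarrow> ereal"
  assumes nm: "\<forall>\<xi>\<in>S. \<phi> \<xi> \<noteq> -\<infinity>" and proper: "\<exists>\<xi>\<in>S. \<phi> \<xi> \<noteq> \<infinity>"
    and conv: "ereal_convex_on S \<phi>" and diff: "ereal_differentiable_on \<phi> S" and \<xi>: "\<xi> \<in> S"
  shows "minimizes \<phi> S \<xi> \<longleftrightarrow> (\<forall>\<eta>\<in>S. 0 \<le> dir_deriv \<phi> \<xi> \<eta>)"
proof
  assume min: "minimizes \<phi> S \<xi>"
  then have fin: "\<phi> \<xi> \<noteq> \<infinity>"
    using proper by (auto simp: minimizes_def)
  have S: "convex S"
    using conv by (simp add: ereal_convex_on_def)
  show "\<forall>\<eta>\<in>S. 0 \<le> dir_deriv \<phi> \<xi> \<eta>"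
  proof
    fix \<eta> assume \<eta>: "\<eta> \<in> S"
    have lim: "((\<lambda>\<alpha>. ereal (1 / \<alpha>) * (\<phi> ((1 - \<alpha>) *\<^sub>R \<xi> + \<alpha> *\<^sub>R \<eta>) - \<phi> \<xi>))
       \<longlongrightarrow> dir_deriv \<phi> \<xi> \<eta>) (at_right (0::real))"
      by (rule dir_deriv_tendsto[OF S nm diff \<xi> fin \<eta>])
    have "\<forall>\<^sub>F \<alpha> in at_right (0::real). \<alpha> \<in> {0<..<1}"
      by (rule eventually_at_right_real) simp
    then have "\<forall>\<^sub>F \<alpha> in at_right 0.
        0 \<le> ereal (1 / \<alpha>) * (\<phi> ((1 - \<alpha>) *\<^sub>R \<xi> + \<alpha> *\<^sub>R \<eta>) - \<phi> \<xi>)"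
    proof eventually_elim
      case (elim \<alpha>)
      let ?z = "(1 - \<alpha>) *\<^sub>R \<xi> + \<alpha> *\<^sub>R \<eta>"
      have "?z \<in> S"
        using convex_line_mem[OF S \<xi> \<eta>] elim by simp
      then have "\<phi> \<xi> \<le> \<phi> ?z"
        using min by (simp add: minimizes_def)
      moreover have "\<bar>\<phi> \<xi>\<bar> \<noteq> \<infinity>"
        using nm \<xi> fin by auto
      ultimately have "0 \<le> \<phi> ?z - \<phi> \<xi>"
        by (cases "\<phi> \<xi>"; cases "\<phi> ?z") auto
      then show ?case
        using elim by simp
    qed
    with lim show "0 \<le> dir_deriv \<phi> \<xi> \<eta>"
      by (rule tendsto_lowerbound) simp
  qed
next
  assume nonneg: "\<forall>\<eta>\<in>S. 0 \<le> dir_deriv \<phi> \<xi> \<eta>"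
  \<comment> \<open>Otherwise the derivative in direction \<xi> itself would be
    -\<infinity>.\<close>
  have fin: "\<phi> \<xi> \<noteq> \<infinity>"
    using nonneg \<xi> by force
  have "\<phi> \<xi> \<le> \<phi> \<eta>" if \<eta>: "\<eta> \<in> S" for \<eta>
  proof (cases "\<phi> \<eta> = \<infinity>")
    case False
    have "0 \<le> \<phi> \<eta> - \<phi> \<xi>"
      using dir_deriv_le_diff[OF nm conv diff \<xi> \<eta> False] nonneg \<eta> order_trans by blast
    then show ?thesis
      using fin nm \<xi> \<eta> by (cases "\<phi> \<xi>"; cases "\<phi> \<eta>") auto
  qed simp
  with \<xi> show "minimizes \<phi> S \<xi>"
    by (simp add: minimizes_def)
qed

section \<open>Decomposition of increments of design vectors\<close>

lemma replace_component_same [simp]: "replace_component \<xi> i (\<xi> $ i) = \<xi>"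
  by (simp add: replace_component_def vec_eq_iff)

lemma replace_component_mem:
  "\<xi> \<in> design_vectors X \<Longrightarrow> w \<in> designs (X i) \<Longrightarrow> replace_component \<xi> i w \<in> design_vectors X"
  by (simp add: design_vectors_def replace_component_def)

lemma one_point_mem: "x \<in> A \<Longrightarrow> one_point x \<in> designs A"
  by (auto simp: designs_def one_point_def axis_def)

text \<open>In component \<open>j\<close> only the summand with \<open>i = j\<close> is
  nonzero.\<close>

lemma diff_eq_sum_replace_component:
  fixes \<xi> \<eta> :: "real ^ 'a::finite ^ 's::finite"
  shows "\<eta> - \<xi> = (\<Sum>i\<in>UNIV. replace_component \<xi> i (\<eta> $ i) - \<xi>)"
proof -
  have "replace_component \<xi> i (\<eta> $ i) $ j - \<xi> $ j = (if i = j then \<eta> $ j - \<xi> $ j else 0)" for i j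
    by (simp add: replace_component_def)
  then show ?thesis
    by (simp add: vec_eq_iff[of "\<eta> - \<xi>"])
qed

text \<open>The weights sum to 1, so the subtracted vector is its own weighted average. A linear map
  therefore takes, at the increment towards \<open>w\<close>, the \<open>w\<close>-average of its
  values at the one-point increments.\<close>

lemma replace_component_diff_eq_sum_one_point:
  fixes \<xi> :: "real ^ 'a::finite ^ 's::finite"
  assumes "w \<in> designs A"
  shows "replace_component \<xi> i w - \<xi> =
    (\<Sum>x\<in>A. w $ x *\<^sub>R (replace_component \<xi> i (one_point x) - \<xi>))"
proof -
  have w: "(\<Sum>x\<in>A. w $ x) = 1" "\<And>x. x \<notin> A \<Longrightarrow> w $ x = 0"
    using assms by (auto simp: designs_def)
  have "w - v = (\<Sum>x\<in>A. w $ x *\<^sub>R (one_point x - v))" for v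
  proof -
    have "(\<Sum>x\<in>A. w $ x *\<^sub>R one_point x) = w"
      using w(2) by (auto simp: vec_eq_iff one_point_def axis_def if_distrib cong: if_cong)
    then show ?thesis
      by (simp add: scaleR_diff_right sum_subtractf w(1) flip: scaleR_sum_left)
  qed
  then show ?thesis
    by (auto simp: vec_eq_iff[of "_ - \<xi>"] replace_component_def)
qed

section \<open>Optimality conditions, support points and saddle points\<close>

theorem theorem1:
  fixes X :: "'s::finite \<Rightarrow> 'a::finite set"
    and \<phi> :: "real ^ 'a ^ 's \<Rightarrow> ereal"
  assumes not_MInf: "\<forall>\<xi>\<in>design_vectors X. \<phi> \<xi> \<noteq> -\<infinity>"
    and proper: "\<exists>\<xi>\<in>design_vectors X. \<phi> \<xi> \<noteq> \<infinity>"
    and convex: "ereal_convex_on (design_vectors X) \<phi>"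
    and differentiable: "ereal_differentiable_on \<phi> (design_vectors X)"
  shows
    "(\<forall>\<xi>s\<in>design_vectors X.
        (minimizes \<phi> (design_vectors X) \<xi>s \<longleftrightarrow>
           (\<forall>\<xi>\<in>design_vectors X. (\<Sum>i\<in>UNIV. partial_dir_deriv \<phi> \<xi>s i (\<xi>s $ i) (\<xi> $ i)) \<ge> 0)) \<and>
        (minimizes \<phi> (design_vectors X) \<xi>s \<longleftrightarrow>
           (\<forall>i. \<forall>w\<in>designs (X i). partial_dir_deriv \<phi> \<xi>s i (\<xi>s $ i) w \<ge> 0)) \<and>
        (minimizes \<phi> (design_vectors X) \<xi>s \<longleftrightarrow>
           (\<forall>i. \<forall>x\<in>X i. partial_dir_deriv \<phi> \<xi>s i (\<xi>s $ i) (one_point x) \<ge> 0)))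
     \<and>
     (\<forall>\<xi>s. minimizes \<phi> (design_vectors X) \<xi>s \<longrightarrow>
        (\<forall>i. \<forall>x\<in>X i. \<xi>s $ i $ x > 0 \<longrightarrow>
           partial_dir_deriv \<phi> \<xi>s i (\<xi>s $ i) (one_point x) = 0))
     \<and>
     (\<forall>\<xi>s. minimizes \<phi> (design_vectors X) \<xi>s \<longrightarrow>
        (\<forall>\<xi>\<in>design_vectors X. \<forall>\<eta>\<in>design_vectors X.
           dir_deriv \<phi> \<xi>s \<xi> \<ge> 0 \<and> dir_deriv \<phi> \<xi>s \<xi>s = 0 \<and> 0 \<ge> dir_deriv \<phi> \<eta> \<xi>s) \<and>
        (\<forall>i. \<forall>w\<in>designs (X i). \<forall>v\<in>designs (X i).
           partial_dir_deriv \<phi> \<xi>s i (\<xi>s $ i) w \<ge> 0 \<and>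
           partial_dir_deriv \<phi> \<xi>s i (\<xi>s $ i) (\<xi>s $ i) = 0 \<and>
           0 \<ge> partial_dir_deriv \<phi> \<xi>s i v (\<xi>s $ i)))"
proof -
  let ?S = "design_vectors X"
  let ?r = replace_component
  note facts = not_MInf convex differentiable
  note min_iff = minimizes_iff_dir_deriv_nonneg[OF not_MInf proper convex differentiable]
  have S: "convex ?S"
    using convex by (simp add: ereal_convex_on_def)
  note deriv = dir_deriv_linear[OF S not_MInf differentiable]
  have pt: "?r \<xi> i (one_point x) \<in> ?S" if "\<xi> \<in> ?S" "x \<in> X i" for \<xi> i x
    using that by (simp add: replace_component_mem one_point_mem)
  have char: "(minimizes \<phi> ?S \<xi>s \<longleftrightarrow>
           (\<forall>\<xi>\<in>?S. (\<Sum>i\<in>UNIV. partial_dir_deriv \<phi> \<xi>s i (\<xi>s $ i) (\<xi> $ i)) \<ge> 0)) \<and>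
        (minimizes \<phi> ?S \<xi>s \<longleftrightarrow>
           (\<forall>i. \<forall>w\<in>designs (X i). partial_dir_deriv \<phi> \<xi>s i (\<xi>s $ i) w \<ge> 0)) \<and>
        (minimizes \<phi> ?S \<xi>s \<longleftrightarrow>
           (\<forall>i. \<forall>x\<in>X i. partial_dir_deriv \<phi> \<xi>s i (\<xi>s $ i) (one_point x) \<ge> 0))"
    if \<xi>s: "\<xi>s \<in> ?S" for \<xi>s
  proof (cases "\<phi> \<xi>s = \<infinity>")
    case True
    have part: "partial_dir_deriv \<phi> \<xi>s i (\<xi>s $ i) w = -\<infinity>" for i w
      using True by (simp add: partial_dir_deriv_def)
    \<comment> \<open>All four statements fail here: the first by properness, the others because the
      derivatives are -\<infinity> and the quantifiers range over nonempty sets. A region is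
      nonempty because weights on the empty set cannot sum to 1.\<close>
    have "\<not> minimizes \<phi> ?S \<xi>s"
      using True proper by (auto simp: minimizes_def)
    moreover have "(\<Sum>i\<in>(UNIV::'s set). -\<infinity>::ereal) = -\<infinity>"
      by (rule finite_ne_induct[OF finite UNIV_not_empty]) auto
    moreover have "designs (X i) \<noteq> {}" for i
      using \<xi>s by (auto simp: design_vectors_def)
    moreover have "X i \<noteq> {}" for i
      proof
      assume "X i = {}"
      moreover have "\<xi>s $ i \<in> designs (X i)"
        using \<xi>s by (simp add: design_vectors_def)
      ultimately show False
        by (simp add: designs_def)
    qed
    ultimately show ?thesis
      using \<xi>s by (auto simp: part)
  next
    case False
    obtain D where lin: "linear D"
      and D: "\<And>\<eta>. \<eta> \<in> ?S \<Longrightarrow> dir_deriv \<phi> \<xi>s \<eta> = ereal (D (\<eta> - \<xi>s))"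
      using deriv[OF \<xi>s False] by blast
    have part: "partial_dir_deriv \<phi> \<xi>s i (\<xi>s $ i) w = ereal (D (?r \<xi>s i w - \<xi>s))"
      if "w \<in> designs (X i)" for i w
      using D[OF replace_component_mem[OF \<xi>s that]] by (simp add: partial_dir_deriv_def)
    have min: "minimizes \<phi> ?S \<xi>s \<longleftrightarrow> (\<forall>\<xi>\<in>?S. 0 \<le> D (\<xi> - \<xi>s))"
      using min_iff[OF \<xi>s] D by simp
    \<comment> \<open>Additivity of \<open>D\<close> makes the sum of the partial derivatives the
      full derivative in direction \<xi>.\<close>
    have split: "(\<Sum>i\<in>UNIV. partial_dir_deriv \<phi> \<xi>s i (\<xi>s $ i) (\<xi> $ i)) = ereal (D (\<xi> - \<xi>s))"
      if "\<xi> \<in> ?S" for \<xi>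
    proof -
      have "\<xi> $ i \<in> designs (X i)" for i
        using that by (simp add: design_vectors_def)
      then show ?thesis
        by (simp add: part linear_sum[OF lin] diff_eq_sum_replace_component[where \<eta> = \<xi>])
    qed
    \<comment> \<open>The scheme is (i) \<longleftrightarrow> (ii), then (i) \<Longrightarrow> (iv)
      \<Longrightarrow> (iii) \<Longrightarrow> (ii).\<close>
    have "minimizes \<phi> ?S \<xi>s \<longleftrightarrow>
        (\<forall>\<xi>\<in>?S. (\<Sum>i\<in>UNIV. partial_dir_deriv \<phi> \<xi>s i (\<xi>s $ i) (\<xi> $ i)) \<ge> 0)" (is "?i \<longleftrightarrow> ?ii")
      using split min by simp
    moreover have "?i \<Longrightarrow> \<forall>i. \<forall>x\<in>X i. partial_dir_deriv \<phi> \<xi>s i (\<xi>s $ i) (one_point x) \<ge> 0"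
      using min pt[OF \<xi>s] by (simp add: part one_point_mem)
    moreover have "\<forall>i. \<forall>w\<in>designs (X i). partial_dir_deriv \<phi> \<xi>s i (\<xi>s $ i) w \<ge> 0"
      if "\<forall>i. \<forall>x\<in>X i. partial_dir_deriv \<phi> \<xi>s i (\<xi>s $ i) (one_point x) \<ge> 0"
    proof (intro allI ballI)
      fix i w assume w: "w \<in> designs (X i)"
      have "0 \<le> D (?r \<xi>s i (one_point x) - \<xi>s)" if "x \<in> X i" for x
        using \<open>\<forall>i. \<forall>x\<in>X i. _\<close> that by (simp add: part one_point_mem)
      then have "0 \<le> D (?r \<xi>s i w - \<xi>s)"
        using w by (simp add: replace_component_diff_eq_sum_one_point[OF w] linear_sum[OF lin]
            linear_scale[OF lin] sum_nonneg designs_def)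
      then show "0 \<le> partial_dir_deriv \<phi> \<xi>s i (\<xi>s $ i) w"
        by (simp add: part[OF w])
    qed
    moreover have ?ii if "\<forall>i. \<forall>w\<in>designs (X i). partial_dir_deriv \<phi> \<xi>s i (\<xi>s $ i) w \<ge> 0"
      using that by (auto simp: design_vectors_def intro!: sum_nonneg)
    ultimately show ?thesis
      by blast
  qed
  have support: "partial_dir_deriv \<phi> \<xi>s i (\<xi>s $ i) (one_point x) = 0"
    if min: "minimizes \<phi> ?S \<xi>s" and x: "x \<in> X i" "\<xi>s $ i $ x > 0" for \<xi>s i x
  proof -
    have \<xi>s: "\<xi>s \<in> ?S" "\<phi> \<xi>s \<noteq> \<infinity>"
      using min proper by (auto simp: minimizes_def)
    obtain D where lin: "linear D"
      and D: "\<And>\<eta>. \<eta> \<in> ?S \<Longrightarrow> dir_deriv \<phi> \<xi>s \<eta> = ereal (D (\<eta> - \<xi>s))"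
      using deriv[OF \<xi>s] by blast
    \<comment> \<open>Decomposing the component \<open>\<xi>s $ i\<close> by its own weights gives
      the zero increment. So the nonnegative terms \<open>?d y\<close> sum to 0 and each vanishes;
      at a support point the positive weight cancels.\<close>
    let ?d = "\<lambda>y. \<xi>s $ i $ y * D (?r \<xi>s i (one_point y) - \<xi>s)"
    have w: "\<xi>s $ i \<in> designs (X i)"
      using \<xi>s by (simp add: design_vectors_def)
    have "(\<Sum>y\<in>X i. ?d y) = D (?r \<xi>s i (\<xi>s $ i) - \<xi>s)"
      by (simp only: replace_component_diff_eq_sum_one_point[OF w] linear_sum[OF lin]
          linear_scale[OF lin] real_scaleR_def)
    then have "(\<Sum>y\<in>X i. ?d y) = 0"
      by (simp add: linear_0[OF lin])
    moreover have "0 \<le> ?d y" if "y \<in> X i" for y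
      using min_iff[OF \<xi>s(1)] min pt[OF \<xi>s(1) that] D w by (simp add: designs_def)
    ultimately have "?d x = 0"
      using x(1) by (simp add: sum_nonneg_eq_0_iff)
    then show ?thesis
      using x D[OF pt[OF \<xi>s(1) x(1)]] by (simp add: partial_dir_deriv_def)
  qed
  have saddle: "dir_deriv \<phi> \<xi>s \<xi> \<ge> 0 \<and> dir_deriv \<phi> \<xi>s \<xi>s = 0 \<and> 0 \<ge> dir_deriv \<phi> \<eta> \<xi>s"
    if min: "minimizes \<phi> ?S \<xi>s" and mem: "\<xi> \<in> ?S" "\<eta> \<in> ?S" for \<xi>s \<xi> \<eta>
  proof -
    have \<xi>s: "\<xi>s \<in> ?S" "\<phi> \<xi>s \<noteq> \<infinity>"
      using min proper by (auto simp: minimizes_def)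
    obtain D where lin: "linear D"
      and D: "\<And>\<eta>. \<eta> \<in> ?S \<Longrightarrow> dir_deriv \<phi> \<xi>s \<eta> = ereal (D (\<eta> - \<xi>s))"
      using deriv[OF \<xi>s] by blast
    \<comment> \<open>The convexity bound is used with base point \<eta>, where \<phi> may be
      infinite; only the endpoint \<xi>s has to have a finite value.\<close>
    have "dir_deriv \<phi> \<eta> \<xi>s \<le> \<phi> \<xi>s - \<phi> \<eta>"
      by (rule dir_deriv_le_diff[OF facts mem(2) \<xi>s])
    also have "\<dots> \<le> 0"
      using min mem(2) not_MInf \<xi>s by (cases "\<phi> \<xi>s"; cases "\<phi> \<eta>") (auto simp: minimizes_def)
    finally show ?thesis
      using min_iff[OF \<xi>s(1)] min mem(1) D[OF \<xi>s(1)] by (simp add: linear_0[OF lin])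
  qed
  have partial_saddle: "partial_dir_deriv \<phi> \<xi>s i (\<xi>s $ i) w \<ge> 0 \<and>
        partial_dir_deriv \<phi> \<xi>s i (\<xi>s $ i) (\<xi>s $ i) = 0 \<and>
        0 \<ge> partial_dir_deriv \<phi> \<xi>s i v (\<xi>s $ i)"
    if min: "minimizes \<phi> ?S \<xi>s" and mem: "w \<in> designs (X i)" "v \<in> designs (X i)" for \<xi>s i w v
  proof -
    have "\<xi>s \<in> ?S"
      using min by (simp add: minimizes_def)
    \<comment> \<open>Partial derivatives are full derivatives between vectors differing only in
      component \<open>i\<close>, and putting \<open>\<xi>s $ i\<close> back gives \<xi>s, so this
      is an instance of \<open>saddle\<close>.\<close>
    then show ?thesis
      using saddle[OF min, of "?r \<xi>s i w" "?r \<xi>s i v"] mem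
      by (simp add: partial_dir_deriv_def replace_component_mem)
  qed
  show ?thesis
    \<comment> \<open>The instantiated forms of \<open>conjI\<close> keep whole the conjunctions
      proved as \<open>char\<close>, \<open>saddle\<close> and
      \<open>partial_saddle\<close>.\<close>
    by (intro conjI[OF ballI[OF char] conjI] conjI[of "Ball _ _"] allI impI ballI
        support saddle partial_saddle)
qed

end
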